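(* Let $X(s,t)$, $s\in[0,1]$, $t\in\mathbb{R}$, be a random spatial field bounded in $[-b,b]$ (with $0<b<\infty$) and Lipschitz in $s$ with constant $\alpha>0$. Let $M$ be the random number of samples generated when a location-unaware mobile sensor samples the field along the path $[0,1]$, let $S_1,S_2,\ldots,S_M$ be the sampling locations, and let $\theta_1,\theta_2,\ldots$ be the inter-sample intervals of the unknown renewal process generating them, with $\mathbb{E}[\theta_1]=\frac1n$ and $0<\theta_1\le\frac{\lambda}{n}$, where $\lambda>1$ is finite. Let $F_{X(s)}$ be the CDF and $f_{X(s)}$ the probability density function of the field value $X(s)$ at location $s$, and let $F_{\hat X(s)}$ be the CDF of its estimate $\hat X(s)=X(S_{\lfloor (M-1)s\rfloor+1})$. Then for every $x\in\mathbb{R}$, every $s\in[0,1]$ and every $\varepsilon>0$, $$\left|F_{X(s)}(x)-F_{\hat X(s)}(x)\right|\le \frac{\alpha^2}{\varepsilon^2}\bigl((n+\lambda-1)s(1-s)+C\bigr)\frac{\lambda^2}{n^2}+2\alpha\,\max_{y\in\mathbb{R}} f_{X(s)}(y)\,\frac{\lambda}{n}\sqrt{(n+\lambda-1)s(1-s)+C},$$ where $C$ is the constant of the location mean squared error bound recalled in the context.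
   Context: Field: $X(s,t)$ is a random field, $s\in[0,1]$ (location on a path normalized to $[0,1]$), $t\in\mathbb{R}$ (time), with $|X(s,t)|\le b$ and $|X(s_1,t)-X(s_2,t)|\le\alpha|s_1-s_2|$ for all $s_1,s_2,t$, for fixed finite $b,\alpha>0$. The field need not be stationary. Sampling model: the inter-sample intervals $\theta_1,\theta_2,\ldots$ are i.i.d. (with unknown distribution), $0<\theta_1\le\lambda/n$, $\mathbb{E}[\theta_1]=1/n$, where $n>0$ is the average spatial sampling rate and $\lambda>1$ is finite. The sampling locations are $S_j=\theta_1+\cdots+\theta_j$. The random number of samples $M$ is determined by $\theta_1+\cdots+\theta_M\le 1$ and $\theta_1+\cdots+\theta_{M+1}>1$. Estimate: the field value at location $s$ at a given time $t_0$, $X(s)=X(s,t_0)$, is estimated by $\hat X(s)=X(S_{\lfloor (M-1)s\rfloor+1},t_0)$, where $t_0$ is the time at which the $(\lfloor (M-1)s\rfloor+1)$-th sample is recorded; the dependence on time is suppressed in the notation. In particular $|X(s)-\hat X(s)|\le\alpha\,|S_{\lfloor (M-1)s\rfloor+1}-s|$. CDFs: $F_{X(s)}(x)=\mathbb{P}(X(s)\le x)$ and $F_{\hat X(s)}(x)=\mathbb{P}(\hat X(s)\le x)$ (the latter is also the limit, as the number of independent trials tends to infinity, of the empirical CDF of the estimates). $f_{X(s)}$ is the probability density function of $X(s)$. Constant $C$: it denotes a constant for which the following bound, known from earlier work, holds for $s\in[0,1]$: $$\mathbb{E}\left[\left|S_{\lfloor (M-1)s\rfloor+1}-s\right|^2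\right]\le\bigl((n+\lambda-1)s(1-s)+C\bigr)\frac{\lambda^2}{n^2}.$$
   Formalization: The formal theorem additionally assumes that the field values X(s,t_0), s in [0,1], are jointly independent of the inter-sample intervals; without this independence the bound fails for large ε. *)

theory Defs
  imports "HOL-Probability.Probability"
begin

text \<open>The inter-sample intervals are \<open>\<theta> 1, \<theta> 2, \<dots>\<close>; the value \<open>\<theta> 0\<close> is never used.\<close>

definition sample_loc :: "(nat \<Rightarrow> 'w \<Rightarrow> real) \<Rightarrow> nat \<Rightarrow> 'w \<Rightarrow> real" where
  "sample_loc \<theta> j \<omega> = (\<Sum>i=1..j. \<theta> i \<omega>)"

text \<open>For positive intervals at most one number satisfies the condition below; for independent
  identically distributed ones it exists almost surely.\<close>

definition num_samples :: "(nat \<Rightarrow> 'w \<Rightarrow> real) \<Rightarrow> 'w \<Rightarrow> nat" where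
  "num_samples \<theta> \<omega> = (THE m. sample_loc \<theta> m \<omega> \<le> 1 \<and> 1 < sample_loc \<theta> (Suc m) \<omega>)"

text \<open>No sample is recorded on the event \<open>m = 0\<close>. There the general formula still gives index
  0 (that is, location 0) if \<open>0 < s \<le> 1\<close>; for \<open>s = 0\<close> it would give index 1, a location
  beyond the end of the path, and we use index 0 for all \<open>s\<close>.\<close>

definition sample_index :: "nat \<Rightarrow> real \<Rightarrow> nat" where
  "sample_index m s = (if m = 0 then 0 else nat \<lfloor>(real m - 1) * s\<rfloor> + 1)"

definition used_loc :: "(nat \<Rightarrow> 'w \<Rightarrow> real) \<Rightarrow> real \<Rightarrow> 'w \<Rightarrow> real" where
  "used_loc \<theta> s \<omega> = sample_loc \<theta> (sample_index (num_samples \<theta> \<omega>) s) \<omega>"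

text \<open>A field is a function \<open>X s t \<omega>\<close> of location, time and outcome. The recording time \<open>t0\<close>
  may be random; a fixed time is the constant function.\<close>

definition field_at :: "(real \<Rightarrow> real \<Rightarrow> 'w \<Rightarrow> real) \<Rightarrow> ('w \<Rightarrow> real) \<Rightarrow> real \<Rightarrow> 'w \<Rightarrow> real" where
  "field_at X t0 s \<omega> = X s (t0 \<omega>) \<omega>"

definition field_estimate ::
  "(real \<Rightarrow> real \<Rightarrow> 'w \<Rightarrow> real) \<Rightarrow> ('w \<Rightarrow> real) \<Rightarrow> (nat \<Rightarrow> 'w \<Rightarrow> real) \<Rightarrow> real \<Rightarrow> 'w \<Rightarrow> real" where
  "field_estimate X t0 \<theta> s \<omega> = field_at X t0 (used_loc \<theta> s \<omega>) \<omega>"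

text \<open>Independence of two families of random variables, as independence of the
  \<open>\<sigma>\<close>-algebras they generate (\<open>indep_var\<close> needs both sides to have the same value type).
  Since \<open>indep_set\<close> requires both collections to consist of events, it also makes the
  families measurable.\<close>

definition indep_families ::
  "'w measure \<Rightarrow> 'i set \<Rightarrow> ('i \<Rightarrow> 'w \<Rightarrow> real) \<Rightarrow> 'j set \<Rightarrow> ('j \<Rightarrow> 'w \<Rightarrow> real) \<Rightarrow> bool" where
  "indep_families M I Y J Z \<longleftrightarrow>
     prob_space.indep_set M
       (sets (vimage_algebra (space M) (\<lambda>\<omega>. \<lambda>i\<in>I. Y i \<omega>) (\<Pi>\<^sub>M i\<in>I. borel)))
       (sets (vimage_algebra (space M) (\<lambda>\<omega>. \<lambda>j\<in>J. Z j \<omega>) (\<Pi>\<^sub>M j\<in>J. borel)))"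

end

theory Submission
  imports Defs
begin

text \<open>
  By the Lipschitz property the field value \<open>Y\<close> and its estimate differ by at most \<open>\<alpha> * D\<close>, where
  \<open>D\<close> is the distance between \<open>s\<close> and the sampling location, so the two events whose
  probabilities are compared differ only inside \<open>\<bar>Y - x\<bar> \<le> \<alpha> * D\<close>. Since \<open>Y\<close> is independent
  of \<open>D\<close> and has density at most \<open>F = (SUP y. f y)\<close>, this event has probability at most
  \<open>2 * F * \<alpha> * E D\<close>, and \<open>E D\<close> is at most the square root of the second moment. This already gives
  the second term of the bound; the first one is not needed, only its nonnegativity.
\<close>

section \<open>Sampling locations along the path\<close>

lemma sample_loc_Suc: "sample_loc \<theta> (Suc j) \<omega> = sample_loc \<theta> j \<omega> + \<theta> (Suc j) \<omega>"
  by (simp add: sample_loc_def)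

lemma sample_loc_0 [simp]: "sample_loc \<theta> 0 \<omega> = 0"
  by (simp add: sample_loc_def)

lemma sample_loc_mono:
  assumes "\<And>i. 1 \<le> i \<Longrightarrow> 0 < \<theta> i \<omega>" and "j \<le> k"
  shows "sample_loc \<theta> j \<omega> \<le> sample_loc \<theta> k \<omega>"
  unfolding sample_loc_def using assms by (intro sum_mono2) (auto intro: less_imp_le)

text \<open>If \<open>m < k\<close>, monotonicity would put the location with index
  \<open>Suc m\<close>, which exceeds 1, at or below the one with index \<open>k\<close>, which does
  not. This is the uniqueness behind the \<open>THE\<close> in \<open>num_samples\<close>.\<close>

lemma sample_loc_crossing_unique:
  assumes pos: "\<And>i. 1 \<le> i \<Longrightarrow> 0 < \<theta> i \<omega>"
    and "sample_loc \<theta> m \<omega> \<le> 1" "1 < sample_loc \<theta> (Suc m) \<omega>"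
    and "sample_loc \<theta> k \<omega> \<le> 1" "1 < sample_loc \<theta> (Suc k) \<omega>"
  shows "m = k"
proof (rule ccontr)
  assume "m \<noteq> k"
  then consider "Suc m \<le> k" | "Suc k \<le> m" by linarith
  then show False
    using sample_loc_mono[of \<theta> \<omega> "Suc m" k] sample_loc_mono[of \<theta> \<omega> "Suc k" m] assms
    by cases force+
qed

lemma sample_index_le:
  assumes "s \<le> 1" shows "sample_index m s \<le> m"
proof (cases "m = 0")
  case False
  then have "(real m - 1) * s \<le> real m - 1"
    using assms by (simp add: mult_left_le)
  then have "\<lfloor>(real m - 1) * s\<rfloor> \<le> int m - 1" by linarith
  then show ?thesis using False by (simp add: sample_index_def)
qed (simp add: sample_index_def)

text \<open>If no number of samples fits, then \<^const>\<open>num_samples\<close> is an unspecified number; but then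
  every sampling location is at most 1, so the location used lies on the path even then.\<close>

lemma used_loc_on_path:
  assumes pos: "\<And>i. 1 \<le> i \<Longrightarrow> 0 < \<theta> i \<omega>" and s: "s \<le> 1"
  shows "used_loc \<theta> s \<omega> \<in> {0..1}"
proof -
  let ?P = "\<lambda>m. sample_loc \<theta> m \<omega> \<le> 1 \<and> 1 < sample_loc \<theta> (Suc m) \<omega>"
  have "sample_loc \<theta> (num_samples \<theta> \<omega>) \<omega> \<le> 1"
  proof (cases "\<exists>m. ?P m")
    case True
    then obtain m where m: "?P m" by blast
    then have "num_samples \<theta> \<omega> = m"
      unfolding num_samples_def using sample_loc_crossing_unique[of \<theta> \<omega>] pos by blast
    then show ?thesis using m by simp
  next
    case False
    have "sample_loc \<theta> j \<omega> \<le> 1" for j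
      using False by (induction j) (auto simp: not_less)
    then show ?thesis .
  qed
  moreover have "sample_loc \<theta> (sample_index m s) \<omega> \<le> sample_loc \<theta> m \<omega>" for m
    by (rule sample_loc_mono[of \<theta> \<omega>, OF pos sample_index_le[OF s]])
  moreover have "0 \<le> sample_loc \<theta> j \<omega>" for j
    using sample_loc_mono[of \<theta> \<omega> 0 j, OF pos] by simp
  ultimately show ?thesis
    unfolding used_loc_def by (meson atLeastAtMost_iff order_trans)
qed

section \<open>Measurability of the location used and of the estimate\<close>

text \<open>The measure space \<open>N\<close> is left open because two cases matter: the underlying
  space itself, and the algebra generated by the intervals, where the result says that the location
  is a function of the intervals alone.\<close>

lemma used_loc_measurable:
  assumes meas: "\<And>i. 1 \<le> i \<Longrightarrow> \<theta> i \<in> borel_measurable N"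
    and pos: "\<And>i \<omega>. 1 \<le> i \<Longrightarrow> \<omega> \<in> space N \<Longrightarrow> 0 < \<theta> i \<omega>"
  shows "used_loc \<theta> s \<in> borel_measurable N"
proof -
  have [measurable]: "sample_loc \<theta> j \<in> borel_measurable N" for j
    unfolding sample_loc_def[abs_def] by (intro borel_measurable_sum meas) simp
  have [measurable]: "num_samples \<theta> \<in> measurable N (count_space UNIV)"
    unfolding num_samples_def[abs_def]
  proof (rule measurable_THE)
    fix m k \<omega>
    assume "\<omega> \<in> space N"
      and "sample_loc \<theta> m \<omega> \<le> 1 \<and> 1 < sample_loc \<theta> (Suc m) \<omega>"
      and "sample_loc \<theta> k \<omega> \<le> 1 \<and> 1 < sample_loc \<theta> (Suc k) \<omega>"
    then show "m = k" using sample_loc_crossing_unique[of \<theta> \<omega>, OF pos] by blast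
  qed (auto intro!: countableI_type)
  show ?thesis
    unfolding used_loc_def[abs_def]
    by (rule measurable_compose_countable[where f = "\<lambda>m \<omega>. sample_loc \<theta> (sample_index m s) \<omega>"])
       measurable
qed

text \<open>The location is rounded down to a multiple of \<open>1 / Suc k\<close>, so that only countably many
  values of the field are composed with it.\<close>

lemma lipschitz_field_compose_measurable:
  fixes Y :: "real \<Rightarrow> 'w \<Rightarrow> real"
  assumes Y: "\<And>s. s \<in> {0..1} \<Longrightarrow> Y s \<in> borel_measurable N"
    and L [measurable]: "L \<in> borel_measurable N"
    and range: "\<And>\<omega>. \<omega> \<in> space N \<Longrightarrow> L \<omega> \<in> {0..1}"
    and lip: "\<And>s1 s2 \<omega>. s1 \<in> {0..1} \<Longrightarrow> s2 \<in> {0..1} \<Longrightarrow> \<omega> \<in> space N \<Longrightarrow>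
      \<bar>Y s1 \<omega> - Y s2 \<omega>\<bar> \<le> \<alpha> * \<bar>s1 - s2\<bar>"
  shows "(\<lambda>\<omega>. Y (L \<omega>) \<omega>) \<in> borel_measurable N"
proof -
  \<comment> \<open>The clamping keeps every grid point on the path, the only place where
    \<open>Y\<close> is known to be measurable, while \<open>i\<close> runs through all integers. At
    the integers that occur on \<open>space N\<close> it changes nothing.\<close>
  define r where "r k i = max 0 (min 1 (real_of_int i / real (Suc k)))" for k i
  have r_range: "r k i \<in> {0..1}" for k i
    by (auto simp: r_def)
  define L' where "L' k \<omega> = r k \<lfloor>real (Suc k) * L \<omega>\<rfloor>" for k \<omega>
  have L'_close: "\<bar>L' k \<omega> - L \<omega>\<bar> \<le> inverse (real (Suc k))" if "\<omega> \<in> space N" for k \<omega>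
  proof -
    let ?i = "\<lfloor>real (Suc k) * L \<omega>\<rfloor>"
    have "real_of_int ?i / real (Suc k) \<le> L \<omega>"
      by (simp add: divide_le_eq mult.commute)
    moreover have "L \<omega> - inverse (real (Suc k)) \<le> real_of_int ?i / real (Suc k)"
    proof -
      have "real (Suc k) * L \<omega> - 1 \<le> real_of_int ?i" by linarith
      then have "(real (Suc k) * L \<omega> - 1) / real (Suc k) \<le> real_of_int ?i / real (Suc k)"
        by (intro divide_right_mono) auto
      then show ?thesis by (simp add: diff_divide_distrib inverse_eq_divide)
    qed
    moreover have "0 \<le> real_of_int ?i / real (Suc k)"
      using range[OF that] by simp
    moreover have "0 \<le> inverse (real (Suc k))"
      by simp
    ultimately show ?thesis
      using range[OF that] unfolding L'_def r_def abs_le_iff atLeastAtMost_iff by linarith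
  qed
  show ?thesis
  proof (rule borel_measurable_LIMSEQ_real)
    fix \<omega> assume \<omega>: "\<omega> \<in> space N"
    have L'_lim: "(\<lambda>k. \<alpha> * \<bar>L' k \<omega> - L \<omega>\<bar>) \<longlonglongrightarrow> 0"
    proof -
      have "(\<lambda>k. \<bar>L' k \<omega> - L \<omega>\<bar>) \<longlonglongrightarrow> 0"
        by (rule tendsto_sandwich[OF _ _ tendsto_const LIMSEQ_inverse_real_of_nat])
           (use L'_close[OF \<omega>] in auto)
      then show ?thesis by (rule tendsto_mult_right_zero)
    qed
    have "(\<lambda>k. Y (L' k \<omega>) \<omega> - Y (L \<omega>) \<omega>) \<longlonglongrightarrow> 0"
      by (rule Lim_null_comparison[OF _ L'_lim])
         (use lip[OF _ _ \<omega>] range[OF \<omega>] r_range in \<open>auto simp: L'_def simp del: of_nat_Suc\<close>)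
    then show "(\<lambda>k. Y (L' k \<omega>) \<omega>) \<longlonglongrightarrow> Y (L \<omega>) \<omega>"
      by (simp add: LIM_zero_iff)
  next
    fix k
    show "(\<lambda>\<omega>. Y (L' k \<omega>) \<omega>) \<in> borel_measurable N"
      unfolding L'_def
      by (rule measurable_compose_countable[where f = "\<lambda>i \<omega>. Y (r k i) \<omega>"])
         (use Y[OF r_range] in measurable)
  qed
qed

text \<open>A member of the family is a coordinate projection after the map that generates the
  algebra. This is how functions of a family are recognised as measurable for the algebras in
  \<open>indep_families\<close>.\<close>

lemma vimage_algebra_component_measurable:
  assumes "i \<in> I"
  shows "Y i \<in> borel_measurable
    (vimage_algebra S (\<lambda>\<omega>. \<lambda>i\<in>I. Y i \<omega>) (\<Pi>\<^sub>M i\<in>I. borel))"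
proof -
  let ?N = "vimage_algebra S (\<lambda>\<omega>. \<lambda>i\<in>I. Y i \<omega>) (\<Pi>\<^sub>M i\<in>I. borel)"
  have "(\<lambda>\<omega>. \<lambda>i\<in>I. Y i \<omega>) \<in> measurable ?N (\<Pi>\<^sub>M i\<in>I. borel)"
    by (rule measurable_vimage_algebra1) (auto simp: space_PiM)
  from measurable_compose[OF this measurable_component_singleton[OF assms]]
  show ?thesis using assms by simp
qed

section \<open>Independence, anti-concentration and comparison of CDFs\<close>

context prob_space
begin

text \<open>The algebras generated by \<open>U\<close> and \<open>V\<close> lie inside
  \<open>A\<close> and \<open>B\<close>, and independence passes to smaller collections of
  events.\<close>

lemma indep_set_imp_indep_var:
  assumes indep: "indep_set (sets A) (sets B)"
    and space: "space A = space M" "space B = space M"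
    and U: "U \<in> measurable A S" and V: "V \<in> measurable B T"
  shows "indep_var S U T V"
proof -
  have sub: "sets A \<subseteq> events" "sets B \<subseteq> events"
    using indep by (auto simp: indep_set_def indep_sets_def UNIV_bool)
  have gen: "sigma_sets (space M) {U -` D \<inter> space M | D. D \<in> sets S} \<subseteq> sets A"
    "sigma_sets (space M) {V -` D \<inter> space M | D. D \<in> sets T} \<subseteq> sets B"
    using sets.sigma_sets_subset[of "{U -` D \<inter> space M | D. D \<in> sets S}" A]
      sets.sigma_sets_subset[of "{V -` D \<inter> space M | D. D \<in> sets T}" B]
      measurable_sets[OF U] measurable_sets[OF V] space by auto
  have "U \<in> measurable M S" "V \<in> measurable M T"
    using U V sub space by (auto simp: measurable_def)
  moreover have "indep_set (sigma_sets (space M) {U -` D \<inter> space M | D. D \<in> sets S})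
      (sigma_sets (space M) {V -` D \<inter> space M | D. D \<in> sets T})"
    unfolding indep_set_def
    by (rule indep_sets_mono_sets[OF indep[unfolded indep_set_def]])
       (use gen in \<open>auto split: bool.split\<close>)
  ultimately show ?thesis by (simp add: indep_var_eq)
qed

text \<open>For a frozen value \<open>d\<close> of \<open>D\<close>, the event puts \<open>Y\<close>
  in an interval of length \<open>2 * d\<close>, whose mass is at most \<open>2 * F * d\<close>.
  Independence makes the joint law a product, so this bound may be integrated over the law of
  \<open>D\<close>.\<close>

lemma prob_near_le_density_bound:
  fixes Y D :: "'a \<Rightarrow> real"
  assumes indep: "indep_var borel Y borel D"
    and density: "distributed M lborel Y (\<lambda>y. ennreal (f y))"
    and F: "\<And>y. f y \<le> F" "0 \<le> F"
    and D: "integrable M D" "\<And>\<omega>. \<omega> \<in> space M \<Longrightarrow> 0 \<le> D \<omega>"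
  shows "prob {\<omega> \<in> space M. \<bar>Y \<omega> - x\<bar> \<le> D \<omega>} \<le> 2 * F * expectation D"
proof -
  note [measurable] = indep_var_rv1[OF indep] indep_var_rv2[OF indep]
  interpret DY: prob_space "distr M borel Y" by (rule prob_space_distr) simp
  interpret DD: prob_space "distr M borel D" by (rule prob_space_distr) simp
  interpret P: pair_sigma_finite "distr M borel Y" "distr M borel D" ..
  let ?Z = "{p. \<bar>fst p - x\<bar> \<le> snd p} :: (real \<times> real) set"
  have "?Z \<in> sets (borel \<Otimes>\<^sub>M borel)"
  proof -
    have "{p \<in> space (borel \<Otimes>\<^sub>M borel). \<bar>fst p - x\<bar> \<le> (snd p :: real)} \<in> sets (borel \<Otimes>\<^sub>M borel)"
      by measurable
    then show ?thesis by (simp add: space_pair_measure)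
  qed
  then have Z: "?Z \<in> sets (distr M borel Y \<Otimes>\<^sub>M distr M borel D)" by simp
  have near: "emeasure (distr M borel Y) ((\<lambda>y. (y, d)) -` ?Z) \<le> ennreal (2 * F * d)"
    if d: "0 \<le> d" for d
  proof -
    have "(\<lambda>y. (y, d)) -` ?Z = {x - d..x + d}"
      by (auto simp: abs_le_iff)
    then have "emeasure (distr M borel Y) ((\<lambda>y. (y, d)) -` ?Z)
        = emeasure M (Y -` {x - d..x + d} \<inter> space M)"
      by (simp add: emeasure_distr)
    also have "\<dots> = (\<integral>\<^sup>+y. ennreal (f y) * indicator {x - d..x + d} y \<partial>lborel)"
      using density by (rule distributed_emeasure) simp
    also have "\<dots> \<le> (\<integral>\<^sup>+y. ennreal F * indicator {x - d..x + d} y \<partial>lborel)"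
      by (intro nn_integral_mono mult_right_mono ennreal_leI F) simp
    also have "\<dots> = ennreal F * ennreal (2 * d)"
      using d by (simp add: nn_integral_cmult_indicator)
    finally show ?thesis
      using F d by (simp add: ennreal_mult[symmetric] mult_ac)
  qed
  have "emeasure M {\<omega> \<in> space M. \<bar>Y \<omega> - x\<bar> \<le> D \<omega>}
      = emeasure (distr M (borel \<Otimes>\<^sub>M borel) (\<lambda>\<omega>. (Y \<omega>, D \<omega>))) ?Z"
    using Z by (subst emeasure_distr) (auto intro!: arg_cong[where f = "emeasure M"])
  also have "\<dots> = emeasure (distr M borel Y \<Otimes>\<^sub>M distr M borel D) ?Z"
    using indep by (simp add: indep_var_distribution_eq)
  also have "\<dots> = (\<integral>\<^sup>+d. emeasure (distr M borel Y) ((\<lambda>y. (y, d)) -` ?Z) \<partial>distr M borel D)"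
    by (rule P.emeasure_pair_measure_alt2[OF Z])
  also have "\<dots> = (\<integral>\<^sup>+\<omega>. emeasure (distr M borel Y) ((\<lambda>y. (y, D \<omega>)) -` ?Z) \<partial>M)"
    by (rule nn_integral_distr) (use P.measurable_emeasure_Pair2[OF Z] in auto)
  also have "\<dots> \<le> (\<integral>\<^sup>+\<omega>. ennreal (2 * F * D \<omega>) \<partial>M)"
    by (intro nn_integral_mono near D)
  also have "\<dots> = ennreal (2 * F * expectation D)"
    using D F by (subst nn_integral_eq_integral) auto
  finally have "ennreal (prob {\<omega> \<in> space M. \<bar>Y \<omega> - x\<bar> \<le> D \<omega>}) \<le> ennreal (2 * F * expectation D)"
    by (simp add: emeasure_eq_measure)
  \<comment> \<open>\<open>ennreal\<close> sends negative reals to 0, so it can be cancelled only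
    once the right-hand side is known to be nonnegative.\<close>
  moreover have "0 \<le> expectation D"
    using D by (intro Bochner_Integration.integral_nonneg) auto
  ultimately show ?thesis
    using F by (simp add: ennreal_le_iff)
qed

text \<open>The variance of \<open>D\<close> is nonnegative.\<close>

lemma expectation_le_sqrt_second_moment:
  fixes D :: "'a \<Rightarrow> real"
  assumes "integrable M D" "integrable M (\<lambda>\<omega>. (D \<omega>)\<^sup>2)"
  shows "expectation D \<le> sqrt (expectation (\<lambda>\<omega>. (D \<omega>)\<^sup>2))"
  using variance_eq[OF assms] variance_positive[of D] by (simp add: real_le_rsqrt)

text \<open>If exactly one of \<open>Y\<close> and \<open>Z\<close> is at most \<open>x\<close>,
  then \<open>x\<close> lies between them, so \<open>Y\<close> is within \<open>D\<close> of
  \<open>x\<close>. The exceptional event no longer mentions \<open>Z\<close>, which for the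
  estimate depends on field and intervals together.\<close>

lemma cdf_distr_diff_le:
  fixes Y Z :: "'a \<Rightarrow> real"
  assumes [measurable]: "random_variable borel Y" "random_variable borel Z" "random_variable borel D"
    and close: "\<And>\<omega>. \<omega> \<in> space M \<Longrightarrow> \<bar>Y \<omega> - Z \<omega>\<bar> \<le> D \<omega>"
  shows "\<bar>cdf (distr M borel Y) x - cdf (distr M borel Z) x\<bar>
    \<le> prob {\<omega> \<in> space M. \<bar>Y \<omega> - x\<bar> \<le> D \<omega>}"
proof -
  let ?A = "\<lambda>W. {\<omega> \<in> space M. W \<omega> \<le> x}" and ?N = "{\<omega> \<in> space M. \<bar>Y \<omega> - x\<bar> \<le> D \<omega>}"
  have cdf_eq: "cdf (distr M borel W) x = prob (?A W)" if "random_variable borel W" for W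
    using that by (simp add: cdf_def measure_distr vimage_def Int_def conj_commute)
  have "prob (?A Y) \<le> prob (?A Z \<union> ?N)" "prob (?A Z) \<le> prob (?A Y \<union> ?N)"
    using close by (auto intro!: finite_measure_mono) (force simp: abs_le_iff)+
  moreover have "prob (?A W \<union> ?N) \<le> prob (?A W) + prob ?N" if [measurable]: "random_variable borel W" for W
    by (intro measure_Un_le; measurable)
  ultimately have "prob (?A Y) \<le> prob (?A Z) + prob ?N" "prob (?A Z) \<le> prob (?A Y) + prob ?N"
    using assms(1,2) by (meson order_trans)+
  then show ?thesis by (simp add: cdf_eq)
qed

end

theorem theorem1:
  fixes M :: "'w measure"
    and X :: "real \<Rightarrow> real \<Rightarrow> 'w \<Rightarrow> real"
    and t0 :: "'w \<Rightarrow> real"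
    and \<theta> :: "nat \<Rightarrow> 'w \<Rightarrow> real"
    and f :: "real \<Rightarrow> real"
    and b \<alpha> n lam C s x \<epsilon> :: real
  assumes "prob_space M"
    and "0 < b" and "0 < \<alpha>" and "0 < n" and "1 < lam"
    and field_rv: "\<And>s t. s \<in> {0..1} \<Longrightarrow> X s t \<in> borel_measurable M"
    and field_bounded: "\<And>s t \<omega>. s \<in> {0..1} \<Longrightarrow> \<omega> \<in> space M \<Longrightarrow> \<bar>X s t \<omega>\<bar> \<le> b"
    and field_lipschitz: "\<And>s1 s2 t \<omega>. s1 \<in> {0..1} \<Longrightarrow> s2 \<in> {0..1} \<Longrightarrow> \<omega> \<in> space M \<Longrightarrow>
          \<bar>X s1 t \<omega> - X s2 t \<omega>\<bar> \<le> \<alpha> * \<bar>s1 - s2\<bar>"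
    and time_rv: "t0 \<in> borel_measurable M"
    and intervals_indep: "prob_space.indep_vars M (\<lambda>_. borel) \<theta> {1..}"
    and intervals_id: "\<And>i. 1 \<le> i \<Longrightarrow> distr M borel (\<theta> i) = distr M borel (\<theta> 1)"
    and intervals_bounds: "\<And>i \<omega>. 1 \<le> i \<Longrightarrow> \<omega> \<in> space M \<Longrightarrow> 0 < \<theta> i \<omega> \<and> \<theta> i \<omega> \<le> lam / n"
    and intervals_mean: "prob_space.expectation M (\<theta> 1) = 1 / n"
    and field_sampling_indep: "indep_families M {0..1} (field_at X t0) {1..} \<theta>"
    and C_bound: "\<And>s. s \<in> {0..1} \<Longrightarrow>
          prob_space.expectation M (\<lambda>\<omega>. \<bar>used_loc \<theta> s \<omega> - s\<bar>\<^sup>2)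
            \<le> ((n + lam - 1) * s * (1 - s) + C) * (lam\<^sup>2 / n\<^sup>2)"
    and "s \<in> {0..1}" and "0 < \<epsilon>"
    and f_nonneg: "\<And>y. 0 \<le> f y"
    and f_density: "distributed M lborel (field_at X t0 s) (\<lambda>y. ennreal (f y))"
    and f_bounded: "bdd_above (range f)"
  shows "\<bar>cdf (distr M borel (field_at X t0 s)) x - cdf (distr M borel (field_estimate X t0 \<theta> s)) x\<bar>
      \<le> \<alpha>\<^sup>2 / \<epsilon>\<^sup>2 * ((n + lam - 1) * s * (1 - s) + C) * (lam\<^sup>2 / n\<^sup>2)
        + 2 * \<alpha> * (SUP y. f y) * (lam / n) * sqrt ((n + lam - 1) * s * (1 - s) + C)"
proof -
  interpret prob_space M by fact
  define Y where "Y = field_at X t0 s"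
  define L where "L = used_loc \<theta> s"
  define D where "D \<omega> = \<bar>L \<omega> - s\<bar>" for \<omega>
  define F where "F = (SUP y. f y)"
  define K where "K = (n + lam - 1) * s * (1 - s) + C"
  let ?A = "vimage_algebra (space M) (\<lambda>\<omega>. \<lambda>i\<in>{0..1}. field_at X t0 i \<omega>) (\<Pi>\<^sub>M i\<in>{0..1}. borel)"
  let ?B = "vimage_algebra (space M) (\<lambda>\<omega>. \<lambda>j\<in>{1..}. \<theta> j \<omega>) (\<Pi>\<^sub>M j\<in>{1..}. borel)"
  have indep: "indep_set (sets ?A) (sets ?B)"
    using field_sampling_indep by (simp add: indep_families_def)
  have events: "sets ?A \<subseteq> events"
    using indep by (auto simp: indep_set_def indep_sets_def UNIV_bool)
  \<comment> \<open>The recording time may be random, so measurability is read off from the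
    independence assumption: \<open>indep_set\<close> admits only collections of events.\<close>
  have field_meas: "field_at X t0 r \<in> borel_measurable M" if "r \<in> {0..1}" for r
    using vimage_algebra_component_measurable[OF that, of "field_at X t0" "space M"] events
    by (auto simp: measurable_def)
  \<comment> \<open>Measurability for \<open>?B\<close>, not just for \<open>M\<close>, is what
    makes the distance \<open>D\<close> independent of the field.\<close>
  have L_B: "L \<in> borel_measurable ?B"
    unfolding L_def using intervals_bounds
    by (intro used_loc_measurable vimage_algebra_component_measurable) auto
  have D_B: "(\<lambda>\<omega>. \<alpha> * D \<omega>) \<in> borel_measurable ?B"
    unfolding D_def using L_B by measurable
  have Y_A: "Y \<in> borel_measurable ?A"
    unfolding Y_def by (rule vimage_algebra_component_measurable) fact
  have YD: "indep_var borel Y borel (\<lambda>\<omega>. \<alpha> * D \<omega>)"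
    by (rule indep_set_imp_indep_var[OF indep _ _ Y_A D_B]) simp_all
  have L_path: "L \<omega> \<in> {0..1}" if "\<omega> \<in> space M" for \<omega>
    unfolding L_def by (rule used_loc_on_path) (use intervals_bounds that \<open>s \<in> {0..1}\<close> in auto)
  have [measurable]: "L \<in> borel_measurable M"
    unfolding L_def using intervals_indep intervals_bounds
    by (intro used_loc_measurable) (auto simp: indep_vars_def)
  have [measurable]: "D \<in> borel_measurable M"
    unfolding D_def by measurable
  have D_bounds: "0 \<le> D \<omega>" "D \<omega> \<le> 1" if "\<omega> \<in> space M" for \<omega>
    using L_path[OF that] \<open>s \<in> {0..1}\<close> by (auto simp: D_def)
  have D_int: "integrable M D" "integrable M (\<lambda>\<omega>. (D \<omega>)\<^sup>2)"
    by (rule integrable_const_bound[where B = 1]; use D_bounds in \<open>auto simp: power_le_one\<close>)+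
  have Z_meas: "field_estimate X t0 \<theta> s \<in> borel_measurable M"
    unfolding field_estimate_def[abs_def] L_def[symmetric]
    by (rule lipschitz_field_compose_measurable[where Y = "field_at X t0" and L = L and \<alpha> = \<alpha>])
       (use field_meas L_path field_lipschitz in \<open>auto simp: field_at_def\<close>)
  have f_le: "f y \<le> F" for y
    unfolding F_def using f_bounded by (rule cSUP_upper[OF UNIV_I])
  have F_nonneg: "0 \<le> F"
    using f_nonneg[of 0] f_le[of 0] by linarith
  have moment: "expectation (\<lambda>\<omega>. (D \<omega>)\<^sup>2) \<le> K * (lam\<^sup>2 / n\<^sup>2)"
    using C_bound[OF \<open>s \<in> {0..1}\<close>] by (simp add: D_def L_def K_def)
  \<comment> \<open>No sign is assumed for \<open>C\<close> or \<open>K\<close>; nonnegativity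
    follows because the left-hand side of \<open>moment\<close> is the mean of a square. It is what
    allows the \<epsilon>-term to be added at the end.\<close>
  then have K_scaled: "0 \<le> K * (lam\<^sup>2 / n\<^sup>2)"
    by (rule order_trans[rotated]) (rule Bochner_Integration.integral_nonneg, simp)
  have "expectation D \<le> sqrt (K * (lam\<^sup>2 / n\<^sup>2))"
    using expectation_le_sqrt_second_moment[OF D_int] moment by (meson order_trans real_sqrt_le_mono)
  \<comment> \<open>Positivity of \<open>lam\<close> and \<open>n\<close> removes the absolute
    values left by the square roots of their squares.\<close>
  also have "\<dots> = lam / n * sqrt K"
    using \<open>0 < n\<close> \<open>1 < lam\<close> by (simp add: real_sqrt_mult real_sqrt_divide)
  finally have mean: "expectation D \<le> lam / n * sqrt K" .
  have "\<bar>cdf (distr M borel Y) x - cdf (distr M borel (field_estimate X t0 \<theta> s)) x\<bar>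
      \<le> prob {\<omega> \<in> space M. \<bar>Y \<omega> - x\<bar> \<le> \<alpha> * D \<omega>}"
  proof (rule cdf_distr_diff_le)
    fix \<omega> assume \<omega>: "\<omega> \<in> space M"
    show "\<bar>Y \<omega> - field_estimate X t0 \<theta> s \<omega>\<bar> \<le> \<alpha> * D \<omega>"
      using field_lipschitz[OF \<open>s \<in> {0..1}\<close> L_path[OF \<omega>] \<omega>]
      by (simp add: Y_def field_estimate_def field_at_def D_def L_def abs_minus_commute)
  qed (use Z_meas field_meas \<open>s \<in> {0..1}\<close> in \<open>auto simp: Y_def\<close>)
  also have "\<dots> \<le> 2 * F * expectation (\<lambda>\<omega>. \<alpha> * D \<omega>)"
    by (rule prob_near_le_density_bound[OF YD f_density[folded Y_def] f_le F_nonneg])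
       (use D_int D_bounds \<open>0 < \<alpha>\<close> in auto)
  also have "\<dots> = 2 * \<alpha> * F * expectation D"
    by simp
  also have "\<dots> \<le> 2 * \<alpha> * F * (lam / n * sqrt K)"
    using mean \<open>0 < \<alpha>\<close> F_nonneg by (intro mult_left_mono) auto
  also have "\<dots> \<le> \<alpha>\<^sup>2 / \<epsilon>\<^sup>2 * (K * (lam\<^sup>2 / n\<^sup>2)) + 2 * \<alpha> * F * (lam / n * sqrt K)"
    using mult_nonneg_nonneg[OF _ K_scaled, of "\<alpha>\<^sup>2 / \<epsilon>\<^sup>2"] by simp
  finally show ?thesis
    by (simp only: Y_def K_def F_def mult.assoc)
qed

end
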